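(* Let $m,n,q\ge 1$ and $1\le k\le m$ be integers, let $\alpha\in\mathbb{R}$, let $B_1,\ldots,B_q\in M_{m,n}$, and let $\Phi^{\pm}_{\alpha,\mathfrak B}:M_n\to M_m$ be the maps \[\Phi^{\pm}_{\alpha,\mathfrak B}(X)=\alpha\,\mathrm{tr}(X)I_m\pm\sum_{s=1}^q B_sXB_s^*\quad (X\in M_n).\] Let $Z=[\mathrm{vec}(B_1)\ \cdots\ \mathrm{vec}(B_q)]\in M_{mn,q}$, regard $ZZ^*$ as an element of $M_n(M_m)$, and define \[\gamma_k^{\pm}=\max_{\substack{V\in M_{m,k}\\ V^*V=I_k}}\lambda_{\max}\big((I_n\otimes V)^*(\mp ZZ^* )^{\tau}(I_n\otimes V)\big).\] Then, for each choice of sign, $\Phi^{\pm}_{\alpha,\mathfrak B}$ is $k$-copositive if and only if $\alpha\ge\gamma_k^{\pm}$ (upper signs go together and lower signs go together).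
   Context: $M_{m,n}$ is the set of $m\times n$ complex matrices, $M_n=M_{n,n}$. For $X\in M_{m,n}$ with columns $x_1,\ldots,x_n$, $\mathrm{vec}(X)\in\mathbb{C}^{mn}$ is the column vector obtained by stacking $x_1,\ldots,x_n$. For a block matrix $A=[A_{ij}]_{i,j=1}^n\in M_n(M_m)$ ($n\times n$ blocks, each $A_{ij}\in M_m$), the partial transpose is $A^\tau=[A_{ji}]_{i,j=1}^n$ (blocks are swapped but not themselves transposed). $\lambda_{\max}(H)$ is the largest eigenvalue of a Hermitian matrix $H$. A linear map $\Phi:M_n\to M_m$ is $k$-positive if for every positive semidefinite block matrix $[A_{ij}]_{i,j=1}^k$ with $A_{ij}\in M_n$, the block matrix $[\Phi(A_{ij})]_{i,j=1}^k$ is positive semidefinite. $\Phi$ is $k$-copositive if $\Phi\circ\mathbf{T}$ is $k$-positive, where $\mathbf{T}(A)=A^\top$ is the transpose map on $M_n$. *)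

theory Defs
  imports "HOL-Analysis.Analysis"
begin

text \<open>
  The matrix space $M_{m,n}$ is rendered as the type \<open>complex^'n^'m\<close> (rows indexed by \<open>'m\<close>), so the
  sizes are the cardinalities of the index types. A matrix of size $kn \times lm$ made of blocks is
  indexed by pairs (block index, index inside the block).
\<close>

definition ctranspose :: "complex^'n^'m \<Rightarrow> complex^'m^'n" where
  "ctranspose A = (\<chi> i j. cnj (A $ j $ i))"

definition hermitian :: "complex^'n^'n \<Rightarrow> bool" where
  "hermitian A \<longleftrightarrow> ctranspose A = A"

text \<open>The quadratic form $x^* A x$ of a Hermitian matrix is real, so taking its real part loses
  nothing.\<close>

definition psd :: "complex^'n^'n \<Rightarrow> bool" where
  "psd A \<longleftrightarrow> hermitian A \<and> (\<forall>x. 0 \<le> Re (\<Sum>i\<in>UNIV. cnj (x $ i) * (A *v x) $ i))"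

definition eigenvalue :: "complex^'n^'n \<Rightarrow> complex \<Rightarrow> bool" where
  "eigenvalue A c \<longleftrightarrow> (\<exists>x. x \<noteq> 0 \<and> A *v x = c *s x)"

text \<open>Intended for Hermitian matrices only; their eigenvalues are all real.\<close>

definition lambda_max :: "complex^'n^'n \<Rightarrow> real" where
  "lambda_max H = (GREATEST l. eigenvalue H (complex_of_real l))"

text \<open>\<open>block_matrix\<close> flattens an array of blocks $[A_{ij}]$, where \<open>A $ i $ j\<close> is the block in block
  row \<open>i\<close> and block column \<open>j\<close>; \<open>blocks\<close> is its inverse.\<close>

definition block_matrix :: "complex^'n^'m^'k^'l \<Rightarrow> complex^('k \<times> 'n)^('l \<times> 'm)" where
  "block_matrix A = (\<chi> p q. A $ fst p $ fst q $ snd p $ snd q)"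

definition blocks :: "complex^('k \<times> 'n)^('l \<times> 'm) \<Rightarrow> complex^'n^'m^'k^'l" where
  "blocks M = (\<chi> i j a b. M $ (i, a) $ (j, b))"

text \<open>Here \<open>transpose\<close> acts on the array of blocks: it exchanges the blocks \<open>(i, j)\<close> and \<open>(j, i)\<close>
  without transposing them.\<close>

definition partial_transpose ::
    "complex^('n::finite \<times> 'm::finite)^('n \<times> 'm) \<Rightarrow> complex^('n \<times> 'm)^('n \<times> 'm)" where
  "partial_transpose M = block_matrix (transpose (blocks M))"

definition kron :: "complex^'b^'a \<Rightarrow> complex^'d^'c \<Rightarrow> complex^('b \<times> 'd)^('a \<times> 'c)" where
  "kron A B = (\<chi> p q. A $ fst p $ fst q * B $ snd p $ snd q)"

text \<open>Stacking of columns: entry \<open>(j, i)\<close> of $\mathrm{vec}(X)$ is the \<open>i\<close>-th entry of the \<open>j\<close>-th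
  column of \<open>X\<close>.\<close>

definition stack_cols :: "complex^'n^'m \<Rightarrow> complex^('n \<times> 'm)" where
  "stack_cols X = (\<chi> p. column (fst p) X $ snd p)"

text \<open>The number $k$ is the cardinality of the index type \<open>'k\<close>, passed as \<open>TYPE('k)\<close>; \<open>map_matrix\<close>
  applies the map to each block. Linearity of the map is not part of the predicates.\<close>

definition k_positive :: "'k::finite itself \<Rightarrow> (complex^'n^'n \<Rightarrow> complex^'m^'m) \<Rightarrow> bool" where
  "k_positive K \<Phi> \<longleftrightarrow>
    (\<forall>A :: complex^'n^'n^'k^'k. psd (block_matrix A) \<longrightarrow> psd (block_matrix (map_matrix \<Phi> A)))"

definition k_copositive :: "'k::finite itself \<Rightarrow> (complex^'n^'n \<Rightarrow> complex^'m^'m) \<Rightarrow> bool" where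
  "k_copositive K \<Phi> \<longleftrightarrow> k_positive K (\<Phi> \<circ> transpose)"

text \<open>\<open>mat c\<close> is the scalar matrix $c I$.\<close>

definition Phi_plus ::
    "real \<Rightarrow> ('q::finite \<Rightarrow> complex^'n^'m) \<Rightarrow> complex^'n^'n \<Rightarrow> complex^'m^'m" where
  "Phi_plus \<alpha> B X =
    mat (complex_of_real \<alpha> * trace X) + (\<Sum>s\<in>UNIV. B s ** X ** ctranspose (B s))"

definition Phi_minus ::
    "real \<Rightarrow> ('q::finite \<Rightarrow> complex^'n^'m) \<Rightarrow> complex^'n^'n \<Rightarrow> complex^'m^'m" where
  "Phi_minus \<alpha> B X =
    mat (complex_of_real \<alpha> * trace X) - (\<Sum>s\<in>UNIV. B s ** X ** ctranspose (B s))"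

definition Zmat :: "('q::finite \<Rightarrow> complex^'n^'m) \<Rightarrow> complex^'q^('n \<times> 'm)" where
  "Zmat B = (\<chi> p s. stack_cols (B s) $ p)"

text \<open>The maximum of $\lambda_{\max}((I_n \otimes V)^* H (I_n \otimes V))$ over all $V \in M_{m,k}$
  with $V^* V = I_k$.\<close>

definition compression_max ::
    "'k::finite itself \<Rightarrow> complex^('n::finite \<times> 'm::finite)^('n \<times> 'm) \<Rightarrow> real" where
  "compression_max K H = (GREATEST g. \<exists>V :: complex^'k^'m. ctranspose V ** V = mat 1 \<and>
    g = lambda_max (ctranspose (kron (mat 1 :: complex^'n^'n) V) ** H **
      kron (mat 1 :: complex^'n^'n) V))"

definition gamma_plus :: "'k::finite itself \<Rightarrow> ('q::finite \<Rightarrow> complex^'n^'m) \<Rightarrow> real" where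
  "gamma_plus K B = compression_max K (partial_transpose (- (Zmat B ** ctranspose (Zmat B))))"

definition gamma_minus :: "'k::finite itself \<Rightarrow> ('q::finite \<Rightarrow> complex^'n^'m) \<Rightarrow> real" where
  "gamma_minus K B = compression_max K (partial_transpose (Zmat B ** ctranspose (Zmat B)))"

end

theory Submission
  imports Defs
begin

text \<open>
  Both maps \<open>\<Phi> \<circ> transpose\<close> have the form $X \mapsto \alpha\,\mathrm{tr}(X) I - L(X)$, where the
  Choi matrix of $L$ is the Hermitian matrix $H = (\mp ZZ^*)^\tau$. Since every positive
  semidefinite matrix is a sum of rank-one matrices, $k$-positivity has to be tested only on block
  matrices $xx^*$. There the quadratic form at $y$ equals $\alpha\|w\|^2 - w^* H w$ with
  $w = \sum_{j=1}^k \bar x_j \otimes y_j$. Orthonormalising $y_1, \ldots, y_k$ (possible inside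
  $\mathbb{C}^m$ because $k \le m$) shows that these $w$ are exactly the vectors $(I \otimes V)u$ with
  $V$ an isometry, so the condition says that $\alpha$ bounds the quadratic form of every
  compression $(I \otimes V)^* H (I \otimes V)$ on unit vectors. The maximum over $V$ and $u$ is
  attained by compactness, and a maximising $u$ is an eigenvector.
\<close>

subsection \<open>Hermitian forms and positive semidefinite matrices\<close>

definition cinner :: "complex^'a \<Rightarrow> complex^'a \<Rightarrow> complex" where
  "cinner x y = (\<Sum>i\<in>UNIV. cnj (x $ i) * y $ i)"

definition outer :: "complex^'a \<Rightarrow> complex^'b \<Rightarrow> complex^'b^'a" where
  "outer x y = (\<chi> i j. x $ i * cnj (y $ j))"

lemma psd_cinner: "psd A \<longleftrightarrow> hermitian A \<and> (\<forall>x. 0 \<le> Re (cinner x (A *v x)))"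
  by (simp add: psd_def cinner_def)

lemma hermitian_entry: "hermitian A \<Longrightarrow> cnj (A $ i $ j) = A $ j $ i"
  unfolding hermitian_def ctranspose_def by (metis vec_lambda_beta)

lemma hermitianI: "(\<And>i j. cnj (A $ i $ j) = A $ j $ i) \<Longrightarrow> hermitian A"
  by (simp add: hermitian_def ctranspose_def vec_eq_iff)

lemma cinner_add_left: "cinner (x + y) z = cinner x z + cinner y z"
  and cinner_add_right: "cinner z (x + y) = cinner z x + cinner z y"
  and cinner_diff_left: "cinner (x - y) z = cinner x z - cinner y z"
  and cinner_diff_right: "cinner z (x - y) = cinner z x - cinner z y"
  by (simp_all add: cinner_def algebra_simps sum.distrib sum_subtractf)

lemma cinner_scale_left: "cinner (c *s x) y = cnj c * cinner x y"
  and cinner_scale_right: "cinner x (c *s y) = c * cinner x y"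
  by (simp_all add: cinner_def sum_distrib_left mult_ac)

lemma cinner_zero_left [simp]: "cinner 0 y = 0"
  and cinner_zero_right [simp]: "cinner x 0 = 0"
  by (simp_all add: cinner_def)

lemma cinner_sum_right: "cinner x (\<Sum>i\<in>I. f i) = (\<Sum>i\<in>I. cinner x (f i))"
  by (induction I rule: infinite_finite_induct) (simp_all add: cinner_add_right)

lemma cinner_sum_left: "cinner (\<Sum>i\<in>I. f i) x = (\<Sum>i\<in>I. cinner (f i) x)"
  by (induction I rule: infinite_finite_induct) (simp_all add: cinner_add_left)

lemma cnj_cinner: "cnj (cinner x y) = cinner y x"
  by (simp add: cinner_def mult.commute)

lemma cinner_self: "cinner x x = of_real ((norm x)\<^sup>2)"
proof -
  have "(norm x)\<^sup>2 = (\<Sum>i\<in>UNIV. (cmod (x $ i))\<^sup>2)"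
    by (simp add: norm_vec_def L2_set_def sum_nonneg)
  then show ?thesis
    by (simp add: cinner_def complex_norm_square mult.commute del: of_real_power)
qed

lemma cinner_self_eq_1: "cinner x x = 1 \<longleftrightarrow> norm x = 1"
proof -
  have "cinner x x = 1 \<longleftrightarrow> (norm x)\<^sup>2 = 1" by (metis cinner_self of_real_eq_1_iff)
  also have "\<dots> \<longleftrightarrow> norm x = 1"
    by (simp only: power2_eq_1_iff) (metis norm_ge_zero not_one_le_zero neg_0_le_iff_le)
  finally show ?thesis .
qed

lemma cinner_axis: "cinner (axis i 1) x = x $ i"
  by (simp add: cinner_def axis_def if_distrib[of cnj] if_distrib[of "\<lambda>z. z * c" for c] cong: if_cong)

lemma mult_axis: "(A *v axis i 1) $ j = (A $ j $ i :: complex)"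
  by (simp add: matrix_vector_mult_def axis_def if_distrib[of "\<lambda>z. c * z" for c] cong: if_cong)

lemma mat_mult: "mat c *v y = c *s (y :: complex^'a)"
  by (simp add: vec_eq_iff matrix_vector_mult_def mat_def if_distrib[of "\<lambda>z. z * d" for d]
      cong: if_cong)

lemma norm_normalize:
  assumes "x \<noteq> 0"
  shows "norm (complex_of_real (1 / norm x) *s x) = 1"
  unfolding cinner_self_eq_1[symmetric] cinner_scale_left cinner_scale_right
  using assms by (simp add: cinner_self power2_eq_square)

lemma cinner_ctranspose: "cinner (ctranspose A *v x) y = cinner x (A *v y)"
proof -
  have "cinner (ctranspose A *v x) y = (\<Sum>i\<in>UNIV. \<Sum>j\<in>UNIV. A $ j $ i * cnj (x $ j) * y $ i)"
    by (simp add: cinner_def matrix_vector_mult_def ctranspose_def sum_distrib_right)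
  also have "\<dots> = (\<Sum>j\<in>UNIV. \<Sum>i\<in>UNIV. A $ j $ i * cnj (x $ j) * y $ i)"
    by (rule sum.swap)
  also have "\<dots> = cinner x (A *v y)"
    by (simp add: cinner_def matrix_vector_mult_def sum_distrib_left mult_ac)
  finally show ?thesis .
qed

lemma cinner_hermitian: "hermitian A \<Longrightarrow> cinner (A *v x) y = cinner x (A *v y)"
  by (metis cinner_ctranspose hermitian_def)

lemma outer_mult: "outer x y *v z = cinner y z *s x"
  by (simp add: outer_def cinner_def matrix_vector_mult_def vec_eq_iff sum_distrib_left sum_distrib_right mult_ac)

lemma hermitian_outer: "hermitian (outer x x)"
  by (rule hermitianI) (simp add: outer_def)

lemma Re_mult_cnj_self: "Re (z * cnj z) = (cmod z)\<^sup>2"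
  by (simp add: complex_mult_cnj cmod_power2)

lemma psd_outer: "psd (outer x x)"
proof -
  have "0 \<le> Re (cinner z (outer x x *v z))" for z
  proof -
    have "cinner z (outer x x *v z) = cinner x z * cnj (cinner x z)"
      by (simp add: outer_mult cinner_scale_right cnj_cinner)
    then show ?thesis by (simp only: Re_mult_cnj_self) simp
  qed
  then show ?thesis by (simp add: psd_cinner hermitian_outer)
qed

text \<open>Moving from \<open>x\<close> to \<open>x - t * A x\<close> changes the form by a
  first-order term -2t|Ax|^2, which would make it negative for small t > 0 unless
  \<open>A *v x\<close> vanishes. The lemma yields both zero columns of psd matrices and
  eigenvectors at extremal vectors.\<close>

lemma hermitian_kernel:
  assumes h: "hermitian A" and nn: "\<And>y. 0 \<le> Re (cinner y (A *v y))"
    and z: "Re (cinner x (A *v x)) = 0"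
  shows "A *v x = 0"
proof (rule ccontr)
  assume ne: "A *v x \<noteq> 0"
  define y where "y = A *v x"
  define a where "a = (norm y)\<^sup>2"
  define b where "b = Re (cinner y (A *v y))"
  have a: "a > 0" using ne by (simp add: a_def y_def)
  have b: "b \<ge> 0" using nn by (simp add: b_def)
  \<comment> \<open>Any t > 0 with t * b < 2 * a gives the contradiction; the + 1 keeps the
    denominator positive when b = 0.\<close>
  define t where "t = a / (b + 1)"
  have t: "t > 0" using a b by (simp add: t_def)
  have "Re (cinner (x - of_real t *s y) (A *v (x - of_real t *s y))) = - 2 * t * a + t\<^sup>2 * b"
  proof -
    have "cinner x (A *v y) = of_real a"
      using cinner_hermitian[OF h, of x y] by (simp add: a_def y_def cinner_self)
    moreover have "cinner y (A *v x) = of_real a"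
      by (simp add: a_def y_def cinner_self)
    ultimately show ?thesis
      using z
      by (simp add: matrix_vector_mult_diff_distrib vector_scalar_commute cinner_diff_left
          cinner_diff_right cinner_scale_left cinner_scale_right b_def power2_eq_square algebra_simps)
  qed
  with nn have "0 \<le> - 2 * t * a + t\<^sup>2 * b" by metis
  then have "2 * t * a \<le> t * (t * b)" by (simp add: power2_eq_square mult_ac)
  then have "2 * a \<le> t * b" using t
    by (simp add: mult.assoc mult.left_commute[of 2])
  moreover have "t * b \<le> a" using a b by (simp add: t_def field_simps)
  ultimately show False using a by linarith
qed

lemma psd_diag:
  assumes "psd A" shows "A $ i $ i = of_real (Re (A $ i $ i))" "0 \<le> Re (A $ i $ i)"
proof -
  have "hermitian A" using assms by (simp add: psd_def)
  then have "cnj (A $ i $ i) = A $ i $ i" by (rule hermitian_entry)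
  then show "A $ i $ i = of_real (Re (A $ i $ i))"
    by (simp add: complex_eq_iff)
  have "0 \<le> Re (cinner (axis i 1) (A *v axis i 1))" using assms by (simp add: psd_cinner)
  then show "0 \<le> Re (A $ i $ i)"
    by (simp add: cinner_axis mult_axis)
qed

text \<open>The form vanishes at \<open>axis i 1\<close>, so \<open>hermitian_kernel\<close>
  annihilates the whole column.\<close>

lemma psd_diag_zero:
  assumes "psd A" "A $ i $ i = 0" shows "A $ j $ i = 0"
proof -
  have "A *v axis i 1 = 0"
    using assms by (intro hermitian_kernel)
      (auto simp: psd_cinner cinner_axis mult_axis)
  then show ?thesis by (simp add: mult_axis vec_eq_iff)
qed

text \<open>\<open>A - outer x x\<close> is the Schur complement of the pivot \<open>A $ p $ p\<close>, padded with zeros.\<close>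

lemma psd_deflate:
  fixes A :: "complex^'a^'a"
  assumes A: "psd A" and ne: "A $ p $ p \<noteq> 0"
  defines "x \<equiv> of_real (1 / sqrt (Re (A $ p $ p))) *s (A *v axis p 1)"
  shows "psd (A - outer x x)" "(A - outer x x) $ p $ p = 0"
    and "A $ i $ i = 0 \<Longrightarrow> (A - outer x x) $ i $ i = 0"
proof -
  define d where "d = Re (A $ p $ p)"
  have App: "A $ p $ p = of_real d" using psd_diag(1)[OF A] by (simp add: d_def)
  have d: "d > 0" using psd_diag[OF A, of p] ne by (metis d_def less_eq_real_def of_real_0)
  have h: "hermitian A" using A by (simp add: psd_def)
  define s where "s = 1 / sqrt d"
  have x: "x $ i = of_real s * A $ i $ p" for i
    by (simp add: x_def d_def s_def mult_axis)
  have dd: "s * s = 1 / d" using d by (simp add: s_def field_simps)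
  have out: "outer x x $ i $ j = A $ i $ p * A $ p $ j / of_real d" for i j
  proof -
    have "outer x x $ i $ j = of_real (s * s) * (A $ i $ p * A $ p $ j)"
      by (simp add: outer_def x hermitian_entry[OF h])
    then show ?thesis unfolding dd by simp
  qed
  show "(A - outer x x) $ p $ p = 0" using d by (simp add: out App)
  show "(A - outer x x) $ i $ i = 0" if "A $ i $ i = 0"
    using psd_diag_zero[OF A that] that hermitian_entry[OF h, of p i] by (simp add: out)
  have herm: "hermitian (A - outer x x)"
    by (rule hermitianI) (simp add: hermitian_entry[OF h] hermitian_entry[OF hermitian_outer])
  have "0 \<le> Re (cinner z ((A - outer x x) *v z))" for z
  proof -
    define e where "e = (axis p 1 :: complex^'a)"
    define c where "c = cinner e (A *v z)"
    \<comment> \<open>Completing the square: this t minimises the form of A along z - t e, and the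
      minimum is exactly the form of the deflated matrix at z.\<close>
    define t where "t = c / of_real d"
    have ce: "cinner z (A *v e) = cnj c"
      by (simp add: c_def cnj_cinner cinner_hermitian[OF h])
    have ee: "cinner e (A *v e) = of_real d"
      by (simp add: e_def cinner_axis mult_axis App)
    have "cinner x z = of_real s * c"
      by (simp add: x_def cinner_scale_left cinner_hermitian[OF h] c_def e_def d_def s_def)
    moreover have "cinner z x = of_real s * cnj c"
      using calculation by (metis cnj_cinner complex_cnj_complex_of_real complex_cnj_mult)
    ultimately have "cinner z ((A - outer x x) *v z)
        = cinner z (A *v z) - of_real (s * s) * (c * cnj c)"
      by (simp add: matrix_vector_mult_diff_rdistrib cinner_diff_right outer_mult cinner_scale_right)
    then have 1: "cinner z ((A - outer x x) *v z) = cinner z (A *v z) - c * cnj c / of_real d"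
      unfolding dd by simp
    have "cinner (z - t *s e) (A *v (z - t *s e))
        = cinner z (A *v z) - t * cnj c - cnj t * c + cnj t * t * of_real d"
      by (simp add: matrix_vector_mult_diff_distrib vector_scalar_commute cinner_diff_left
          cinner_diff_right cinner_scale_left cinner_scale_right ce ee algebra_simps flip: c_def)
    also have "\<dots> = cinner z (A *v z) - c * cnj c / of_real d"
      using d by (simp add: t_def field_simps)
    finally show ?thesis using 1 A by (metis psd_cinner)
  qed
  with herm show "psd (A - outer x x)" by (simp add: psd_cinner)
qed

text \<open>Induction on the number of nonzero diagonal entries: each deflation clears the pivot and
  revives no zero entry, and a psd matrix with zero diagonal is 0. Additive properties thus need
  checking only on rank-one matrices.\<close>

lemma psd_induct [consumes 1, case_names zero add outer]:
  fixes A :: "complex^'a^'a"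
  assumes "psd A" and z: "P 0" and a: "\<And>A B. P A \<Longrightarrow> P B \<Longrightarrow> P (A + B)"
    and o: "\<And>x. P (outer x x)"
  shows "P A"
  using assms(1)
proof (induction "card {i. A $ i $ i \<noteq> 0}" arbitrary: A rule: less_induct)
  case less
  show ?case
  proof (cases "\<exists>p. A $ p $ p \<noteq> 0")
    case False
    then have "A = 0" using psd_diag_zero[OF less.prems] by (auto simp: vec_eq_iff)
    then show ?thesis using z by simp
  next
    case True
    then obtain p where p: "A $ p $ p \<noteq> 0" by blast
    define x where "x = of_real (1 / sqrt (Re (A $ p $ p))) *s (A *v axis p 1)"
    note D = psd_deflate[OF less.prems p, folded x_def]
    have "{i. (A - outer x x) $ i $ i \<noteq> 0} \<subset> {i. A $ i $ i \<noteq> 0}"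
      using D(2,3) p by blast
    then have "P (A - outer x x)"
      by (intro less.hyps psubset_card_mono D(1)) simp_all
    from a[OF this o[of x]] show ?thesis by simp
  qed
qed

subsection \<open>Largest eigenvalues of compressions by isometries\<close>

text \<open>With M the maximum of the form on unit vectors, M I - K is nonnegative and its form
  vanishes at \<open>x\<close>, so \<open>hermitian_kernel\<close> makes \<open>x\<close> an
  eigenvector. Evaluating the form at any other eigenvector bounds its eigenvalue by M.\<close>

lemma lambda_max_eqI:
  fixes K :: "complex^'a^'a"
  assumes h: "hermitian K" and x: "norm x = 1"
    and mx: "\<And>y. norm y = 1 \<Longrightarrow> Re (cinner y (K *v y)) \<le> Re (cinner x (K *v x))"
  shows "lambda_max K = Re (cinner x (K *v x))"
proof -
  define M where "M = Re (cinner x (K *v x))"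
  define L where "L = mat (complex_of_real M) - K"
  have L: "L *v y = complex_of_real M *s y - K *v y" for y
    by (simp add: L_def matrix_vector_mult_diff_rdistrib mat_mult)
  have form: "Re (cinner y (L *v y)) = M * (norm y)\<^sup>2 - Re (cinner y (K *v y))" for y
    by (simp add: L cinner_diff_right cinner_scale_right cinner_self flip: of_real_power)
  have bound: "Re (cinner y (K *v y)) \<le> M * (norm y)\<^sup>2" for y
  proof (cases "y = 0")
    case False
    define z where "z = complex_of_real (1 / norm y) *s y"
    have "norm z = 1" using False unfolding z_def by (rule norm_normalize)
    from mx[OF this] have "Re (cinner z (K *v z)) \<le> M" by (simp add: M_def)
    moreover have "cinner z (K *v z) = complex_of_real (1 / (norm y)\<^sup>2) * cinner y (K *v y)"
      by (simp add: z_def vector_scalar_commute cinner_scale_left cinner_scale_right power2_eq_square)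
    ultimately have "Re (cinner y (K *v y)) / (norm y)\<^sup>2 \<le> M" by simp
    then show ?thesis using False by (simp add: divide_le_eq)
  qed simp
  have "hermitian L"
    by (rule hermitianI) (auto simp: L_def mat_def hermitian_entry[OF h])
  then have "L *v x = 0"
    by (rule hermitian_kernel) (use bound in \<open>auto simp: form x M_def\<close>)
  then have ev: "eigenvalue K (complex_of_real M)"
    unfolding eigenvalue_def L using x by (intro exI[of _ x]) auto
  have "l \<le> M" if ev: "eigenvalue K (complex_of_real l)" for l
  proof -
    obtain y where y: "y \<noteq> 0" "K *v y = complex_of_real l *s y"
      using ev by (auto simp: eigenvalue_def)
    then have "Re (cinner y (K *v y)) = l * (norm y)\<^sup>2"
      by (simp add: cinner_scale_right cinner_self flip: of_real_power)
    with bound[of y] y(1) show ?thesis by simp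
  qed
  with ev show ?thesis
    unfolding lambda_max_def M_def[symmetric] by (intro Greatest_equality)
qed

section \<open>Orthonormal families and isometries\<close>

text \<open>The orthogonality conditions are the kernel of a square matrix with a zero row.\<close>

lemma exists_orthogonal_unit:
  fixes v :: "'k::finite \<Rightarrow> complex^'m"
  assumes "card J < CARD('m)"
  shows "\<exists>u. norm u = 1 \<and> (\<forall>i\<in>J. cinner (v i) u = 0)"
proof -
  have "card J \<le> card (UNIV :: 'm set)" using assms by simp
  then obtain f :: "'k \<Rightarrow> 'm" where f: "inj_on f J"
    using card_le_inj[of J "UNIV :: 'm set"] by auto
  have "card (f ` J) < CARD('m)" using assms f by (simp add: card_image)
  \<comment> \<open>The strict cardinality bound leaves a row index free; it becomes the zero row of
    M.\<close>
  then obtain a0 where a0: "a0 \<notin> f ` J" by (metis UNIV_eq_I order_less_irrefl)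
  define M :: "complex^'m^'m"
    where "M = (\<chi> a b. if a \<in> f ` J then cnj (v (inv_into J f a) $ b) else 0)"
  have "row a0 M = 0" using a0 by (simp add: row_def M_def vec_eq_iff)
  then have "det M = 0" by (rule det_zero_row)
  then have "\<not> (\<exists>N. N ** M = mat 1)"
    using invertible_det_nz[of M] by (simp add: invertible_left_inverse)
  then obtain x where x: "x \<noteq> 0" "M *v x = 0" by (auto simp: matrix_left_invertible_ker)
  define u where "u = complex_of_real (1 / norm x) *s x"
  have "cinner (v i) x = 0" if "i \<in> J" for i
  proof -
    have "cinner (v i) x = (M *v x) $ f i"
      using that f by (simp add: M_def matrix_vector_mult_def cinner_def)
    then show ?thesis using x by simp
  qed
  then have "\<forall>i\<in>J. cinner (v i) u = 0" by (simp add: u_def cinner_scale_right)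
  moreover have "norm u = 1" using x(1) unfolding u_def by (rule norm_normalize)
  ultimately show ?thesis by auto
qed

text \<open>Gram-Schmidt that tolerates linear dependence: when a residual vanishes, an arbitrary
  unit vector orthogonal to the earlier ones is inserted, which the dimension bound makes possible.
  Hence the orthonormal family is always indexed by all of \<open>J\<close>.\<close>

lemma gram_schmidt_family:
  fixes y :: "'k::finite \<Rightarrow> complex^'m"
  assumes "card J \<le> CARD('m)"
  shows "\<exists>v c. (\<forall>i\<in>J. \<forall>j\<in>J. cinner (v i) (v j) = (if i = j then 1 else 0)) \<and>
    (\<forall>j\<in>J. y j = (\<Sum>i\<in>J. c i j *s v i))"
  using finite[of J] assms
proof (induction J rule: finite_induct)
  case (insert k J)
  then obtain v c where orth: "\<And>i j. i \<in> J \<Longrightarrow> j \<in> J \<Longrightarrow> cinner (v i) (v j) = (if i = j then 1 else 0)"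
    and span: "\<And>j. j \<in> J \<Longrightarrow> y j = (\<Sum>i\<in>J. c i j *s v i)"
    by force
  define r where "r = y k - (\<Sum>i\<in>J. cinner (v i) (y k) *s v i)"
  have r: "cinner (v i) r = 0" if "i \<in> J" for i
    using that insert.hyps(1)
    by (simp add: r_def cinner_diff_right cinner_sum_right cinner_scale_right orth if_distrib
        cong: if_cong)
  have "\<exists>u d. cinner u u = 1 \<and> (\<forall>i\<in>J. cinner (v i) u = 0) \<and> r = d *s u"
  proof (cases "r = 0")
    case True
    \<comment> \<open>Since k is not in J, the bound on \<open>insert k J\<close> gives the strict
      inequality card J < CARD('m) required here.\<close>
    obtain u where u: "norm u = 1" "\<forall>i\<in>J. cinner (v i) u = 0"
      using exists_orthogonal_unit[of J v] insert by auto
    then have "cinner u u = 1 \<and> (\<forall>i\<in>J. cinner (v i) u = 0) \<and> r = 0 *s u"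
      using True by (simp add: cinner_self)
    then show ?thesis by blast
  next
    case False
    define u where "u = complex_of_real (1 / norm r) *s r"
    have "cinner u u = 1 \<and> (\<forall>i\<in>J. cinner (v i) u = 0) \<and> r = complex_of_real (norm r) *s u"
      using norm_normalize[OF False, folded u_def] False r
      by (simp add: cinner_self_eq_1) (simp add: u_def cinner_scale_right)
    then show ?thesis by blast
  qed
  then obtain u d where u: "cinner u u = 1" "\<And>i. i \<in> J \<Longrightarrow> cinner (v i) u = 0" "r = d *s u"
    by blast
  have u': "cinner u (v i) = 0" if "i \<in> J" for i
    using u(2)[OF that] by (metis cnj_cinner complex_cnj_zero)
  define v' where "v' = v(k := u)"
  \<comment> \<open>Column k holds the projection coefficients of y k together with d; the old
    columns receive coefficient 0 on the new vector.\<close>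
  define c' where "c' i j = (if j = k then if i = k then d else cinner (v i) (y k)
    else if i = k then 0 else c i j)" for i j
  have vJ: "v' i = v i" if "i \<in> J" for i using that insert.hyps(2) by (auto simp: v'_def)
  have "(\<Sum>i\<in>J. c' i j *s v' i) = (\<Sum>i\<in>J. (if j = k then cinner (v i) (y k) else c i j) *s v i)" for j
    by (rule sum.cong) (use vJ insert.hyps(2) in \<open>auto simp: c'_def\<close>)
  then have "y j = (\<Sum>i\<in>insert k J. c' i j *s v' i)" if "j \<in> insert k J" for j
    using that insert.hyps span[of j] u(3)
    by (auto simp: v'_def c'_def r_def algebra_simps)
  moreover have "cinner (v' i) (v' j) = (if i = j then 1 else 0)"
    if "i \<in> insert k J" "j \<in> insert k J" for i j
    using that insert.hyps(2) by (auto simp: v'_def u u' orth)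
  ultimately show ?case by blast
qed simp

lemma isometry_entry_iff:
  fixes V :: "complex^'k^'m"
  shows "ctranspose V ** V = mat 1 \<longleftrightarrow>
    (\<forall>i j. cinner (column i V) (column j V) = (if i = j then 1 else 0))"
  by (simp add: vec_eq_iff matrix_matrix_mult_def mat_def cinner_def column_def ctranspose_def)

text \<open>A QR factorisation without triangularity of \<open>C\<close>. \<open>V\<close> is a full
  isometry even when \<open>Y\<close> is rank deficient.\<close>

lemma isometry_factorization:
  fixes Y :: "complex^'k^'m"
  assumes "CARD('k) \<le> CARD('m)"
  obtains V :: "complex^'k^'m" and C :: "complex^'k^'k" where "ctranspose V ** V = mat 1" "Y = V ** C"
proof -
  obtain v :: "'k \<Rightarrow> complex^'m" and c where
    v: "\<And>i j. cinner (v i) (v j) = (if i = j then 1 else 0)" and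
    c: "\<And>j. column j Y = (\<Sum>i\<in>UNIV. c i j *s v i)"
    using gram_schmidt_family[of UNIV "\<lambda>j. column j Y", OF assms] unfolding ball_UNIV by blast
  define V :: "complex^'k^'m" where "V = (\<chi> a i. v i $ a)"
  have col: "column i V = v i" for i by (simp add: column_def V_def vec_eq_iff)
  have "Y $ a $ j = (\<Sum>i\<in>UNIV. c i j * v i $ a)" for a j
    using arg_cong[OF c[of j], of "\<lambda>w. w $ a"] by (simp add: column_def)
  then have "Y = V ** (\<chi> i j. c i j)"
    by (simp add: vec_eq_iff matrix_matrix_mult_def V_def mult.commute)
  moreover have "ctranspose V ** V = mat 1" by (simp add: isometry_entry_iff col v)
  ultimately show ?thesis using that by blast
qed

text \<open>The set is closed as the solution set of a continuous equation, and bounded because unit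
  columns have entries of modulus at most 1.\<close>

lemma compact_isometries: "compact {V :: complex^'k^'m. ctranspose V ** V = mat 1}"
proof -
  have "norm V \<le> (\<Sum>a\<in>(UNIV::'m set). \<Sum>j\<in>(UNIV::'k set). 1)"
    if V: "ctranspose V ** V = mat 1" for V :: "complex^'k^'m"
  proof -
    have "cmod (V $ a $ j) \<le> 1" for a j
    proof -
      have "cinner (column j V) (column j V) = 1" using V unfolding isometry_entry_iff by simp
      then have "norm (column j V) = 1" by (simp only: cinner_self_eq_1)
      then show ?thesis using Finite_Cartesian_Product.norm_nth_le[of "column j V" a]
        by (simp add: column_def)
    qed
    then have "(\<Sum>j\<in>UNIV. cmod (V $ a $ j)) \<le> (\<Sum>j\<in>(UNIV::'k set). 1)" for a
      by (intro sum_mono)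
    moreover have "norm (V $ a) \<le> (\<Sum>j\<in>UNIV. cmod (V $ a $ j))" for a
      unfolding norm_vec_def[of "V $ a"] by (intro L2_set_le_sum) simp
    ultimately have "norm (V $ a) \<le> (\<Sum>j\<in>(UNIV::'k set). 1)" for a
      by (meson order.trans)
    then have "(\<Sum>a\<in>UNIV. norm (V $ a)) \<le> (\<Sum>a\<in>(UNIV::'m set). \<Sum>j\<in>(UNIV::'k set). 1)"
      by (intro sum_mono)
    moreover have "norm V \<le> (\<Sum>a\<in>UNIV. norm (V $ a))"
      unfolding norm_vec_def[of V] by (intro L2_set_le_sum) simp
    ultimately show ?thesis by linarith
  qed
  then have "bounded {V :: complex^'k^'m. ctranspose V ** V = mat 1}"
    by (auto simp: bounded_iff)
  moreover have "closed {V :: complex^'k^'m. ctranspose V ** V = mat 1}"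
    unfolding matrix_matrix_mult_def ctranspose_def
    by (intro closed_Collect_eq continuous_intros)
  ultimately show ?thesis by (simp add: compact_eq_bounded_closed)
qed

section \<open>Compressions by the identity tensored with an isometry\<close>

lemma kron_one_mult:
  fixes V :: "complex^'k^'m" and u :: "complex^('n::finite \<times> 'k)"
  shows "(kron (mat 1 :: complex^'n^'n) V *v u) $ (q, a) = (\<Sum>j\<in>UNIV. V $ a $ j * u $ (q, j))"
proof -
  have "(kron (mat 1 :: complex^'n^'n) V *v u) $ (q, a)
      = (\<Sum>p\<in>UNIV. \<Sum>j\<in>UNIV. (if q = p then 1 else 0) * V $ a $ j * u $ (p, j))"
    by (simp add: matrix_vector_mult_def kron_def mat_def sum.cartesian_product case_prod_beta
        flip: UNIV_Times_UNIV)
  also have "\<dots> = (\<Sum>p\<in>UNIV. if q = p then \<Sum>j\<in>UNIV. V $ a $ j * u $ (p, j) else 0)"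
    by (rule sum.cong) auto
  finally show ?thesis by simp
qed

lemma cinner_pair:
  fixes x y :: "complex^('n::finite \<times> 'm::finite)"
  shows "cinner x y = (\<Sum>q\<in>UNIV. \<Sum>a\<in>UNIV. cnj (x $ (q, a)) * y $ (q, a))"
  by (simp add: cinner_def sum.cartesian_product case_prod_beta flip: UNIV_Times_UNIV)

text \<open>The operator applies \<open>V\<close> separately to each of the slices u(q, -), and
  \<open>V\<close> preserves the inner product.\<close>

lemma norm_kron_isometry:
  fixes V :: "complex^'k^'m" and u :: "complex^('n::finite \<times> 'k)"
  assumes "ctranspose V ** V = mat 1"
  shows "norm (kron (mat 1 :: complex^'n^'n) V *v u) = norm u"
proof -
  have "(\<Sum>a\<in>UNIV. cnj (\<Sum>j\<in>UNIV. V $ a $ j * u $ (q, j)) * (\<Sum>j\<in>UNIV. V $ a $ j * u $ (q, j)))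
      = (\<Sum>j\<in>UNIV. cnj (u $ (q, j)) * u $ (q, j))" for q
  proof -
    define z :: "complex^'k" where "z = (\<chi> j. u $ (q, j))"
    have "cinner (V *v z) (V *v z) = cinner (ctranspose V *v (V *v z)) z"
      by (simp add: cinner_ctranspose)
    then have "cinner (V *v z) (V *v z) = cinner z z"
      by (simp add: matrix_vector_mul_assoc assms)
    then show ?thesis by (simp add: cinner_def matrix_vector_mult_def z_def)
  qed
  then have "cinner (kron (mat 1 :: complex^'n^'n) V *v u) (kron (mat 1 :: complex^'n^'n) V *v u)
      = cinner u u"
    by (simp add: cinner_pair kron_one_mult)
  then have "(norm (kron (mat 1 :: complex^'n^'n) V *v u))\<^sup>2 = (norm u)\<^sup>2"
    by (simp only: cinner_self of_real_eq_iff)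
  then show ?thesis by simp
qed

lemma ctranspose_mult: "ctranspose (A ** B) = ctranspose B ** ctranspose A"
  by (simp add: ctranspose_def matrix_matrix_mult_def vec_eq_iff mult.commute)

lemma ctranspose_ctranspose [simp]: "ctranspose (ctranspose A) = A"
  by (simp add: ctranspose_def vec_eq_iff)

lemma hermitian_congruence: "hermitian H \<Longrightarrow> hermitian (ctranspose W ** H ** W)"
  by (simp add: hermitian_def ctranspose_mult matrix_mul_assoc)

text \<open>The two nested \<open>GREATEST\<close> operators become one maximum of the form over the
  compact set of pairs (isometry, unit vector); homogeneity in u then removes the
  normalisation.\<close>

lemma compression_max_le_iff:
  fixes H :: "complex^('n::finite \<times> 'm::finite)^('n \<times> 'm)"
  assumes h: "hermitian H" and km: "CARD('k::finite) \<le> CARD('m)"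
  shows "compression_max TYPE('k) H \<le> \<alpha> \<longleftrightarrow>
    (\<forall>(V :: complex^'k^'m) u. ctranspose V ** V = mat 1 \<longrightarrow>
      (let w = kron (mat 1 :: complex^'n^'n) V *v u in Re (cinner w (H *v w)) \<le> \<alpha> * (norm w)\<^sup>2))"
proof -
  define W where "W V = kron (mat 1 :: complex^'n^'n) V" for V :: "complex^'k^'m"
  define F where "F V u = Re (cinner (W V *v u) (H *v (W V *v u)))"
    for V :: "complex^'k^'m" and u
  define S where "S = {V :: complex^'k^'m. ctranspose V ** V = mat 1}"
  have F: "Re (cinner u ((ctranspose (W V) ** H ** W V) *v u)) = F V u" for V u
    by (metis (no_types, lifting) F_def cinner_ctranspose ctranspose_ctranspose
        matrix_vector_mul_assoc)
  have contF: "continuous_on T (\<lambda>p. F (fst p) (snd p))" for T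
    unfolding F_def cinner_def W_def kron_def matrix_vector_mult_def
    by (intro continuous_intros)
  have lam: "lambda_max (ctranspose (W V) ** H ** W V) = F V u"
    if "norm u = 1" "\<And>y. norm y = 1 \<Longrightarrow> F V y \<le> F V u" for V u
    using lambda_max_eqI[OF hermitian_congruence[OF h], of u "W V"] that by (simp add: F)
  have neU: "sphere 0 1 \<noteq> ({} :: (complex^('n \<times> 'k)) set)" by simp
  \<comment> \<open>For a fixed V the sphere is compact, so every competing largest eigenvalue is
    itself a value of F.\<close>
  have ex: "\<exists>u. norm u = 1 \<and> lambda_max (ctranspose (W V) ** H ** W V) = F V u" for V
  proof -
    have "continuous_on (sphere 0 1) (F V)"
      unfolding F_def[abs_def] cinner_def matrix_vector_mult_def by (intro continuous_intros)
    from continuous_attains_sup[OF compact_sphere neU this] lam[of _ V] show ?thesis by force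
  qed
  \<comment> \<open>Factoring the zero matrix shows that an isometry exists at all; this uses the
    dimension bound.\<close>
  obtain V0 :: "complex^'k^'m" where V0: "V0 \<in> S"
    using isometry_factorization[OF km, where Y = 0] by (auto simp: S_def)
  then have "S \<times> sphere 0 1 \<noteq> ({} :: ((complex^'k^'m) \<times> (complex^('n \<times> 'k))) set)"
    using neU by auto
  moreover have "compact S" unfolding S_def by (rule compact_isometries)
  ultimately have "\<exists>p\<in>S \<times> sphere 0 1. \<forall>p'\<in>S \<times> sphere 0 1. F (fst p') (snd p') \<le> F (fst p) (snd p)"
    by (intro continuous_attains_sup compact_Times compact_sphere contF)
  then obtain V u where Vu: "V \<in> S" "norm u = 1"
    and mx: "\<And>V' y. V' \<in> S \<Longrightarrow> norm y = 1 \<Longrightarrow> F V' y \<le> F V u"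
    by auto
  have cm: "compression_max TYPE('k) H = F V u"
    unfolding compression_max_def W_def[symmetric]
  proof (rule Greatest_equality)
    show "\<exists>V' :: complex^'k^'m. ctranspose V' ** V' = mat 1 \<and>
        F V u = lambda_max (ctranspose (W V') ** H ** W V')"
      \<comment> \<open>The u of a joint maximiser is in particular a maximiser for its own
        V.\<close>
      using Vu mx lam[of u V] by (auto simp: S_def)
  next
    fix g assume "\<exists>V' :: complex^'k^'m. ctranspose V' ** V' = mat 1 \<and>
        g = lambda_max (ctranspose (W V') ** H ** W V')"
    then obtain V' where "V' \<in> S" "g = lambda_max (ctranspose (W V') ** H ** W V')"
      by (auto simp: S_def)
    with ex[of V'] mx[of V'] show "g \<le> F V u" by auto
  qed
  show ?thesis
    unfolding cm W_def[symmetric] Let_def F_def[symmetric]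
  proof safe
    fix V' :: "complex^'k^'m" and y
    assume le: "F V u \<le> \<alpha>" and V': "ctranspose V' ** V' = mat 1"
    have nw: "norm (W V' *v y) = norm y" using norm_kron_isometry[OF V'] by (simp add: W_def)
    show "F V' y \<le> \<alpha> * (norm (W V' *v y))\<^sup>2"
    proof (cases "y = 0")
      case False
      define z where "z = complex_of_real (1 / norm y) *s y"
      have "norm z = 1" using False unfolding z_def by (rule norm_normalize)
      then have "F V' z \<le> \<alpha>" using mx[of V' z] V' le by (simp add: S_def)
      moreover have "F V' z = F V' y / (norm y)\<^sup>2"
        by (simp add: F_def z_def vector_scalar_commute cinner_scale_left cinner_scale_right
            power2_eq_square)
      ultimately show ?thesis using False by (simp add: nw divide_le_eq)
    qed (simp add: F_def nw)
  next
    assume "\<forall>V y. ctranspose V ** V = mat 1 \<longrightarrow> F V y \<le> \<alpha> * (norm (W V *v y))\<^sup>2"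
    then have "F V u \<le> \<alpha> * (norm (W V *v u))\<^sup>2" using Vu by (simp add: S_def)
    moreover have "norm (W V *v u) = 1"
      using Vu norm_kron_isometry[of V u] by (simp add: S_def W_def)
    ultimately show "F V u \<le> \<alpha>" by simp
  qed
qed

subsection \<open>Positivity of maps given by their Choi matrix\<close>

text \<open>\<open>choi_map \<alpha> H\<close> sends $X$ to $\alpha\,\mathrm{tr}(X) I - L(X)$, where $L$ is the linear map with
  Choi matrix $[L(E_{pq})]_{p,q} = H$.\<close>

definition choi_map ::
    "real \<Rightarrow> complex^('n::finite \<times> 'm::finite)^('n \<times> 'm) \<Rightarrow> complex^'n^'n \<Rightarrow> complex^'m^'m" where
  "choi_map \<alpha> H X = mat (complex_of_real \<alpha> * trace X) -
    (\<chi> a b. \<Sum>p\<in>UNIV. \<Sum>q\<in>UNIV. X $ p $ q * H $ (p, a) $ (q, b))"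

text \<open>The conjugate on \<open>x\<close> cancels against the one in \<open>cinner\<close>, so
  the form of \<open>choi_map\<close> at a rank-one matrix becomes a form of
  \<open>H\<close>.\<close>

definition conj_tensor :: "complex^'n::finite \<Rightarrow> complex^'m::finite \<Rightarrow> complex^('n \<times> 'm)" where
  "conj_tensor x y = (\<chi> r. cnj (x $ fst r) * y $ snd r)"

definition slice :: "'k::finite \<Rightarrow> complex^('k \<times> 'n::finite) \<Rightarrow> complex^'n" where
  "slice j x = (\<chi> p. x $ (j, p))"

definition contract ::
    "complex^('k::finite \<times> 'n::finite) \<Rightarrow> complex^('k \<times> 'm::finite) \<Rightarrow> complex^('n \<times> 'm)" where
  "contract x y = (\<Sum>j\<in>UNIV. conj_tensor (slice j x) (slice j y))"

lemma contract_entry: "contract x y $ (p, a) = (\<Sum>j\<in>UNIV. cnj (x $ (j, p)) * y $ (j, a))"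
  by (simp add: contract_def conj_tensor_def slice_def)

lemma blocks_inverse: "block_matrix (blocks M) = M"
  by (simp add: blocks_def block_matrix_def)

lemma choi_map_add: "choi_map \<alpha> H (X + Y) = choi_map \<alpha> H X + choi_map \<alpha> H Y"
  by (simp add: choi_map_def trace_def mat_def vec_eq_iff algebra_simps sum.distrib)

lemma matrix_vector_mult_pair:
  fixes M :: "complex^('n::finite \<times> 'm::finite)^'a"
  shows "(M *v y) $ i = (\<Sum>q\<in>UNIV. \<Sum>b\<in>UNIV. M $ i $ (q, b) * y $ (q, b))"
  by (simp add: matrix_vector_mult_def sum.cartesian_product case_prod_beta flip: UNIV_Times_UNIV)

lemma cinner_slices:
  "cinner x y = (\<Sum>j\<in>UNIV. cinner (slice j x) (slice j y))"
  by (simp add: cinner_pair) (simp add: cinner_def slice_def)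

lemma slice_block_matrix_mult:
  fixes A :: "complex^'m::finite^'m^'k::finite^'k"
  shows "slice i (block_matrix A *v y) = (\<Sum>j\<in>UNIV. A $ i $ j *v slice j y)"
  by (simp add: vec_eq_iff slice_def matrix_vector_mult_pair block_matrix_def)
    (simp add: matrix_vector_mult_def)

lemma cinner_conj_tensor: "cinner (conj_tensor x y) (conj_tensor x' y') = cinner x' x * cinner y y'"
  by (simp add: cinner_pair) (simp add: cinner_def conj_tensor_def sum_product mult_ac)

text \<open>Four independent vectors are needed because an off-diagonal block of a rank-one block
  matrix pairs two different slices.\<close>

lemma choi_map_outer:
  "cinner y (choi_map \<alpha> H (outer x x') *v y') =
    complex_of_real \<alpha> * cinner (conj_tensor x y) (conj_tensor x' y') - cinner (conj_tensor x y) (H *v conj_tensor x' y')"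
proof -
  define K where
    "K = (\<chi> a b. \<Sum>p\<in>UNIV. \<Sum>q\<in>UNIV. outer x x' $ p $ q * H $ (p, a) $ (q, b))"
  have "trace (outer x x') = cinner x' x"
    by (simp add: trace_def outer_def cinner_def mult.commute)
  then have form: "cinner y (choi_map \<alpha> H (outer x x') *v y') =
      complex_of_real \<alpha> * cinner (conj_tensor x y) (conj_tensor x' y') - cinner y (K *v y')"
    by (simp add: choi_map_def matrix_vector_mult_diff_rdistrib mat_mult cinner_diff_right
        cinner_scale_right cinner_conj_tensor mult.assoc flip: K_def)
  have "(K *v y') $ a = (\<Sum>p\<in>UNIV. x $ p * (H *v conj_tensor x' y') $ (p, a))" for a
  proof -
    define f where "f p q b = x $ p * (H $ (p, a) $ (q, b) * (cnj (x' $ q) * y' $ b))" for p q b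
    have "(K *v y') $ a = (\<Sum>b\<in>UNIV. \<Sum>p\<in>UNIV. \<Sum>q\<in>UNIV. f p q b)"
      by (simp add: K_def matrix_vector_mult_def outer_def f_def sum_distrib_left
          sum_distrib_right mult_ac)
    also have "\<dots> = (\<Sum>p\<in>UNIV. \<Sum>b\<in>UNIV. \<Sum>q\<in>UNIV. f p q b)"
      by (rule sum.swap)
    also have "\<dots> = (\<Sum>p\<in>UNIV. \<Sum>q\<in>UNIV. \<Sum>b\<in>UNIV. f p q b)"
      by (rule sum.cong[OF refl], rule sum.swap)
    finally show ?thesis
      by (simp add: matrix_vector_mult_pair f_def conj_tensor_def sum_distrib_left)
  qed
  then have "cinner y (K *v y') =
      (\<Sum>a\<in>UNIV. \<Sum>p\<in>UNIV. x $ p * cnj (y $ a) * (H *v conj_tensor x' y') $ (p, a))"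
    by (simp add: cinner_def sum_distrib_left mult_ac)
  also have "\<dots> = (\<Sum>p\<in>UNIV. \<Sum>a\<in>UNIV. x $ p * cnj (y $ a) * (H *v conj_tensor x' y') $ (p, a))"
    by (rule sum.swap)
  also have "\<dots> = cinner (conj_tensor x y) (H *v conj_tensor x' y')"
    by (simp add: cinner_pair) (simp add: conj_tensor_def)
  finally have "cinner y (K *v y') = cinner (conj_tensor x y) (H *v conj_tensor x' y')" .
  with form show ?thesis by simp
qed

text \<open>Each block of \<open>outer x x\<close> is an outer product of slices; summing
  \<open>choi_map_outer\<close> over all block pairs collects, by sesquilinearity, into one form at
  \<open>contract x y\<close>.\<close>

lemma choi_map_outer_form:
  fixes x :: "complex^('k::finite \<times> 'n::finite)" and y :: "complex^('k \<times> 'm::finite)"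
  shows "cinner y (block_matrix (map_matrix (choi_map \<alpha> H) (blocks (outer x x))) *v y) =
    complex_of_real \<alpha> * cinner (contract x y) (contract x y) -
    cinner (contract x y) (H *v contract x y)"
proof -
  have "blocks (outer x x) $ i $ j = outer (slice i x) (slice j x)" for i j
    by (simp add: blocks_def outer_def slice_def vec_eq_iff)
  then have "cinner y (block_matrix (map_matrix (choi_map \<alpha> H) (blocks (outer x x))) *v y) =
      (\<Sum>i\<in>UNIV. \<Sum>j\<in>UNIV. cinner (slice i y)
        (choi_map \<alpha> H (outer (slice i x) (slice j x)) *v slice j y))"
    by (simp add: cinner_slices[of y] slice_block_matrix_mult map_matrix_def cinner_sum_right)
  moreover have "H *v contract x y = (\<Sum>j\<in>UNIV. H *v conj_tensor (slice j x) (slice j y))"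
    by (simp add: contract_def vec.linear_sum)
  then have "cinner (contract x y) (H *v contract x y) = (\<Sum>i\<in>UNIV. \<Sum>j\<in>UNIV.
      cinner (conj_tensor (slice i x) (slice i y)) (H *v conj_tensor (slice j x) (slice j y)))"
    by (simp only: contract_def[of x y] cinner_sum_left) (simp only: cinner_sum_right)
  moreover have "cinner (contract x y) (contract x y) = (\<Sum>i\<in>UNIV. \<Sum>j\<in>UNIV.
      cinner (conj_tensor (slice i x) (slice i y)) (conj_tensor (slice j x) (slice j y)))"
    unfolding contract_def by (subst cinner_sum_left) (simp only: cinner_sum_right)
  ultimately show ?thesis
    by (simp add: choi_map_outer sum_subtractf sum_distrib_left)
qed

lemma hermitian_choi_map:
  fixes A :: "complex^'n::finite^'n^'k::finite^'k" and H :: "complex^('n \<times> 'm::finite)^('n \<times> 'm)"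
  assumes h: "hermitian H" and A: "hermitian (block_matrix A)"
  shows "hermitian (block_matrix (map_matrix (choi_map \<alpha> H) A))"
proof (rule hermitianI)
  fix r s :: "'k \<times> 'm"
  obtain i a j b where [simp]: "r = (i, a)" "s = (j, b)" by (cases r, cases s)
  have A': "cnj (A $ i $ j $ p $ q) = A $ j $ i $ q $ p" for p q
    using hermitian_entry[OF A, of "(i, p)" "(j, q)"] by (simp add: block_matrix_def)
  \<comment> \<open>Conjugating the entries of A and H exchanges the roles of p and q, so the double
    sum has to be reindexed.\<close>
  have "(\<Sum>p\<in>UNIV. \<Sum>q\<in>UNIV. A $ j $ i $ q $ p * H $ (q, b) $ (p, a)) =
      (\<Sum>p\<in>UNIV. \<Sum>q\<in>UNIV. A $ j $ i $ p $ q * H $ (p, b) $ (q, a))"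
    by (rule sum.swap)
  then show "cnj (block_matrix (map_matrix (choi_map \<alpha> H) A) $ r $ s) =
      block_matrix (map_matrix (choi_map \<alpha> H) A) $ s $ r"
    by (auto simp: block_matrix_def map_matrix_def choi_map_def trace_def mat_def A' hermitian_entry[OF h])
qed

text \<open>The form of the image is additive in the block matrix, so \<open>psd_induct\<close>
  reduces nonnegativity to rank-one arguments.\<close>

lemma k_positive_choi_map_iff:
  fixes H :: "complex^('n::finite \<times> 'm::finite)^('n \<times> 'm)"
  assumes h: "hermitian H"
  shows "k_positive TYPE('k::finite) (choi_map \<alpha> H) \<longleftrightarrow>
    (\<forall>(x :: complex^('k \<times> 'n)) (y :: complex^('k \<times> 'm)).
      Re (cinner (contract x y) (H *v contract x y)) \<le> \<alpha> * (norm (contract x y))\<^sup>2)"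
    (is "_ \<longleftrightarrow> ?R")
proof -
  define F where "F M y = Re (cinner y (block_matrix (map_matrix (choi_map \<alpha> H) (blocks M)) *v y))"
    for M :: "complex^('k \<times> 'n)^('k \<times> 'n)" and y
  have F: "F (outer x x) y = \<alpha> * (norm (contract x y))\<^sup>2 - Re (cinner (contract x y) (H *v contract x y))"
    for x y by (simp add: F_def choi_map_outer_form cinner_self flip: of_real_power)
  have bm: "blocks (block_matrix A) = A" for A :: "complex^'n^'n^'k^'k"
    by (simp add: vec_eq_iff blocks_def block_matrix_def)
  show ?thesis
  proof
    assume "k_positive TYPE('k) (choi_map \<alpha> H)"
    then have "psd (block_matrix (map_matrix (choi_map \<alpha> H) (blocks (outer x x))))"
      for x :: "complex^('k \<times> 'n)"
      by (simp add: k_positive_def blocks_inverse psd_outer)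
    then have "0 \<le> F (outer x x) y" for x y by (simp add: psd_cinner F_def)
    then show ?R by (simp add: F)
  next
    assume R: ?R
    have "0 \<le> F M y" if "psd M" for M y
      using that
    proof (induction M rule: psd_induct)
      case zero
      have "map_matrix (choi_map \<alpha> H) (blocks (0 :: complex^('k \<times> 'n)^('k \<times> 'n))) = 0"
        by (simp add: vec_eq_iff map_matrix_def choi_map_def blocks_def trace_def mat_def)
      then have "block_matrix (map_matrix (choi_map \<alpha> H) (blocks (0 :: complex^('k \<times> 'n)^('k \<times> 'n)))) = 0"
        by (simp add: vec_eq_iff block_matrix_def)
      then show ?case by (simp add: F_def)
    next
      case (add M N)
      have "blocks (M + N) = blocks M + blocks N" by (simp add: blocks_def vec_eq_iff)
      then have "map_matrix (choi_map \<alpha> H) (blocks (M + N)) =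
          map_matrix (choi_map \<alpha> H) (blocks M) + map_matrix (choi_map \<alpha> H) (blocks N)"
        by (simp only: map_matrix_def) (subst vec_eq_iff, subst vec_eq_iff, simp add: choi_map_add)
      then have "block_matrix (map_matrix (choi_map \<alpha> H) (blocks (M + N))) =
          block_matrix (map_matrix (choi_map \<alpha> H) (blocks M)) +
          block_matrix (map_matrix (choi_map \<alpha> H) (blocks N))"
        by (simp only:) (simp add: vec_eq_iff block_matrix_def)
      then have "F (M + N) y = F M y + F N y"
        by (simp add: F_def matrix_vector_mult_add_rdistrib cinner_add_right)
      with add show ?case by simp
    next
      case (outer x)
      then show ?case using R by (simp add: F)
    qed
    then have "0 \<le> Re (cinner y (block_matrix (map_matrix (choi_map \<alpha> H) A) *v y))"
      if "psd (block_matrix A)" for A :: "complex^'n^'n^'k^'k" and y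
      using \<open>\<And>M y. psd M \<Longrightarrow> 0 \<le> F M y\<close>[OF that, of y] by (simp add: F_def bm)
    then show "k_positive TYPE('k) (choi_map \<alpha> H)"
      by (simp add: k_positive_def psd_cinner hermitian_choi_map[OF h])
  qed
qed

section \<open>Contracted vectors as images of isometries\<close>

lemma contract_eq_kron_isometry:
  fixes x :: "complex^('k::finite \<times> 'n::finite)" and y :: "complex^('k \<times> 'm::finite)"
  assumes "CARD('k) \<le> CARD('m)"
  obtains V :: "complex^'k^'m" and u where "ctranspose V ** V = mat 1"
    "contract x y = kron (mat 1 :: complex^'n^'n) V *v u"
proof -
  obtain V :: "complex^'k^'m" and C :: "complex^'k^'k"
    where V: "ctranspose V ** V = mat 1" and C: "(\<chi> a j. y $ (j, a)) = V ** C"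
    using isometry_factorization[OF assms] by blast
  have y: "y $ (j, a) = (\<Sum>l\<in>UNIV. V $ a $ l * C $ l $ j)" for j a
    using arg_cong[OF C, of "\<lambda>M. M $ a $ j"] by (simp add: matrix_matrix_mult_def)
  define u where "u = (\<chi> r. \<Sum>j\<in>UNIV. C $ snd r $ j * cnj (x $ (j, fst r)))"
  have "contract x y $ (q, a) = (kron (mat 1 :: complex^'n^'n) V *v u) $ (q, a)" for q a
  proof -
    have "contract x y $ (q, a) =
        (\<Sum>j\<in>UNIV. \<Sum>l\<in>UNIV. V $ a $ l * (C $ l $ j * cnj (x $ (j, q))))"
      by (simp add: contract_entry y sum_distrib_left mult_ac)
    also have "\<dots> = (\<Sum>l\<in>UNIV. \<Sum>j\<in>UNIV. V $ a $ l * (C $ l $ j * cnj (x $ (j, q))))"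
      by (rule sum.swap)
    finally show ?thesis by (simp add: kron_one_mult u_def sum_distrib_left)
  qed
  then have "contract x y = kron (mat 1 :: complex^'n^'n) V *v u" by (simp add: vec_eq_iff)
  with V that show ?thesis by blast
qed

text \<open>Converse direction: take Y = V, and let X^* be the matrix whose vec is u, which explains
  the conjugate in the first witness.\<close>

lemma kron_mult_eq_contract:
  fixes V :: "complex^'k^'m" and u :: "complex^('n::finite \<times> 'k)"
  shows "kron (mat 1 :: complex^'n^'n) V *v u =
    contract (\<chi> r. cnj (u $ (snd r, fst r))) (\<chi> r. V $ snd r $ fst r)"
  by (simp add: vec_eq_iff kron_one_mult contract_entry mult.commute)

lemma k_positive_choi_map_compression:
  fixes H :: "complex^('n::finite \<times> 'm::finite)^('n \<times> 'm)"
  assumes "hermitian H" "CARD('k::finite) \<le> CARD('m)"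
  shows "k_positive TYPE('k) (choi_map \<alpha> H) \<longleftrightarrow> compression_max TYPE('k) H \<le> \<alpha>"
  unfolding compression_max_le_iff[OF assms] k_positive_choi_map_iff[OF assms(1)] Let_def
proof safe
  fix V :: "complex^'k^'m" and u :: "complex^('n \<times> 'k)"
  assume "\<forall>(x :: complex^('k \<times> 'n)) (y :: complex^('k \<times> 'm)).
    Re (cinner (contract x y) (H *v contract x y)) \<le> \<alpha> * (norm (contract x y))\<^sup>2"
  then show "Re (cinner (kron (mat 1 :: complex^'n^'n) V *v u) (H *v (kron (mat 1) V *v u)))
      \<le> \<alpha> * (norm (kron (mat 1 :: complex^'n^'n) V *v u))\<^sup>2"
    unfolding kron_mult_eq_contract by blast
next
  fix x :: "complex^('k \<times> 'n)" and y :: "complex^('k \<times> 'm)"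
  obtain V :: "complex^'k^'m" and u where
    V: "ctranspose V ** V = mat 1" "contract x y = kron (mat 1 :: complex^'n^'n) V *v u"
    using contract_eq_kron_isometry[OF assms(2)] .
  assume "\<forall>(V :: complex^'k^'m) u. ctranspose V ** V = mat 1 \<longrightarrow>
    Re (cinner (kron (mat 1 :: complex^'n^'n) V *v u) (H *v (kron (mat 1) V *v u)))
      \<le> \<alpha> * (norm (kron (mat 1 :: complex^'n^'n) V *v u))\<^sup>2"
  with V show "Re (cinner (contract x y) (H *v contract x y)) \<le> \<alpha> * (norm (contract x y))\<^sup>2"
    by simp
qed

section \<open>Choi matrices of the two given maps\<close>

lemma partial_transpose_gram:
  fixes B :: "'q::finite \<Rightarrow> complex^'n^'m"
  shows "partial_transpose (Zmat B ** ctranspose (Zmat B)) $ (p, a) $ (q, b) =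
    (\<Sum>s\<in>UNIV. B s $ a $ q * cnj (B s $ b $ p))"
  by (simp add: partial_transpose_def block_matrix_def blocks_def transpose_def Zmat_def
      stack_cols_def column_def matrix_matrix_mult_def ctranspose_def)

lemma partial_transpose_uminus: "partial_transpose (- M) = - partial_transpose M"
  by (simp add: partial_transpose_def block_matrix_def blocks_def transpose_def vec_eq_iff)

lemma hermitian_partial_transpose_gram:
  fixes B :: "'q::finite \<Rightarrow> complex^'n^'m"
  shows "hermitian (partial_transpose (Zmat B ** ctranspose (Zmat B)))"
proof (rule hermitianI)
  fix r s :: "'n \<times> 'm"
  show "cnj (partial_transpose (Zmat B ** ctranspose (Zmat B)) $ r $ s) =
      partial_transpose (Zmat B ** ctranspose (Zmat B)) $ s $ r"
    by (cases r, cases s) (simp add: partial_transpose_gram mult.commute)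
qed

lemma hermitian_uminus: "hermitian M \<Longrightarrow> hermitian (- M)"
  by (rule hermitianI) (simp add: hermitian_entry)

text \<open>Here the transpose from copositivity meets the partial transpose: replacing X by its
  transpose swaps p and q in the coefficient of X(p, q), which is the block swap in ZZ^*.\<close>

lemma sum_congruence_transpose_entry:
  fixes B :: "'q::finite \<Rightarrow> complex^'n^'m" and X :: "complex^'n^'n"
  shows "(\<Sum>s\<in>UNIV. B s ** transpose X ** ctranspose (B s)) $ a $ b =
    (\<Sum>p\<in>UNIV. \<Sum>q\<in>UNIV. X $ p $ q *
      partial_transpose (Zmat B ** ctranspose (Zmat B)) $ (p, a) $ (q, b))"
proof -
  have "(\<Sum>s\<in>UNIV. B s ** transpose X ** ctranspose (B s)) $ a $ b =
      (\<Sum>s\<in>UNIV. \<Sum>p\<in>UNIV. \<Sum>q\<in>UNIV. X $ p $ q * (B s $ a $ q * cnj (B s $ b $ p)))"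
    by (simp add: matrix_matrix_mult_def transpose_def ctranspose_def sum_distrib_left
        sum_distrib_right mult_ac)
  also have "\<dots> = (\<Sum>p\<in>UNIV. \<Sum>q\<in>UNIV. \<Sum>s\<in>UNIV. X $ p $ q * (B s $ a $ q * cnj (B s $ b $ p)))"
    by (subst sum.swap, intro sum.cong refl, rule sum.swap)
  finally show ?thesis by (simp add: partial_transpose_gram sum_distrib_left)
qed

lemma trace_transpose: "trace (transpose X) = trace X"
  by (simp add: trace_def transpose_def)

text \<open>\<open>choi_map\<close> subtracts its linear part, so the plus sign of the map turns
  into a minus sign on ZZ^*.\<close>

lemma Phi_plus_transpose:
  "Phi_plus \<alpha> B \<circ> transpose =
    choi_map \<alpha> (partial_transpose (- (Zmat B ** ctranspose (Zmat B))))"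
  by (rule ext) (simp add: Phi_plus_def choi_map_def vec_eq_iff mat_def trace_transpose
      sum_congruence_transpose_entry partial_transpose_uminus sum_negf del: sum_component)

lemma Phi_minus_transpose:
  "Phi_minus \<alpha> B \<circ> transpose =
    choi_map \<alpha> (partial_transpose (Zmat B ** ctranspose (Zmat B)))"
  by (rule ext) (simp add: Phi_minus_def choi_map_def vec_eq_iff mat_def trace_transpose
      sum_congruence_transpose_entry del: sum_component)

theorem theorem4p6:
  fixes \<alpha> :: real and B :: "'q::finite \<Rightarrow> complex^'n^'m"
  assumes "CARD('k::finite) \<le> CARD('m)"
  shows "(k_copositive TYPE('k) (Phi_plus \<alpha> B) \<longleftrightarrow> \<alpha> \<ge> gamma_plus TYPE('k) B) \<and>
         (k_copositive TYPE('k) (Phi_minus \<alpha> B) \<longleftrightarrow> \<alpha> \<ge> gamma_minus TYPE('k) B)"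
  using assms hermitian_partial_transpose_gram[of B]
  by (simp add: k_copositive_def Phi_plus_transpose Phi_minus_transpose gamma_plus_def
      gamma_minus_def k_positive_choi_map_compression partial_transpose_uminus hermitian_uminus)

end
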